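(* Let $\Gamma$ be a connected graph with $n$ edges and graph hypersurface $X_\Gamma\subset\mathbb{P}^{n-1}$. Let $S\subset E_\Gamma$ be a set of edges, $L\subset\mathbb{P}^{n-1}$ the coordinate linear space defined by $A_e=0$, $e\in S$, and $G(L)=\bigcup_{e\in S}e\subset\Gamma$ the corresponding subgraph. Then $L$ is contained in $X_\Gamma$ if and only if $h_1(G(L))>0$.
   Context: Graphs are finite, and $E_\Gamma$ is the set of edges of $\Gamma$. $h_1(G)=\operatorname{rank}H_1(G,\mathbb{Z})$; $G(L)$ is the (not necessarily connected) subgraph consisting of the edges in $S$ and their endpoints. Orient the edges, so that $H_1(\Gamma,\mathbb{Z})\subset\mathbb{Z}[E_\Gamma]$ is the kernel of the boundary map to the free abelian group on the vertices. Choosing a basis $h_1,\dots,h_d$ of $H_1(\Gamma,\mathbb{Z})$ and writing $e^\vee$ for the coordinate functional of the edge $e$, the graph polynomial of $\Gamma$ is $\Psi_\Gamma(A)=\det\big(\sum_{e}A_e\,e^\vee(h_j)e^\vee(h_k)\big)_{j,k}$ in variables $A_e$, $e\in E_\Gamma$; equivalently $\Psi_\Gamma(A)=\sum_T\prod_{e\notin T}A_e$, the sum over spanning trees $T$ of $\Gamma$ (subgraphs that are trees containing every vertex). $X_\Gamma$ is the hypersurface $\Psi_\Gamma=0$ in the projective space $\mathbb{P}^{n-1}$ over a field, with homogeneous coordinates $A_e$, $e\in E_\Gamma$.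
   Formalization: The case where S is the set of all edges and Γ is a tree (h_1(Γ)=0) is excluded: there L and X_Γ are both empty, so L is contained in X_Γ although h_1(G(L))=0. *)

theory Defs
  imports
    "Graph_Theory.Digraph_Component"
    "Jordan_Normal_Form.Determinant"
    "HOL-Library.Poly_Mapping"
    "HOL-Algebra.Algebraic_Closure_Type"
begin

text \<open>
  A finite graph with oriented edges is a \<^locale>\<open>fin_digraph\<close>; loops and multiple edges are
  allowed. Connectedness (\<^const>\<open>Digraph_Component.connected\<close>) ignores the orientation and
  requires at least one vertex. The free abelian group on a type of edges or vertices is
  \<open>'a \<Rightarrow>\<^sub>0 int\<close>, and the coordinate functional of \<open>e\<close> on it is
  \<open>\<lambda>c. Poly_Mapping.lookup c e\<close>.
\<close>

interpretation frag: Modules.module frag_cmul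
  by unfold_locales (simp_all add: frag_cmul_distrib frag_cmul_distrib2)

definition boundary :: "('v, 'e) pre_digraph \<Rightarrow> ('e \<Rightarrow>\<^sub>0 int) \<Rightarrow> ('v \<Rightarrow>\<^sub>0 int)" where
  "boundary G = frag_extend (\<lambda>e. frag_of (head G e) - frag_of (tail G e))"

definition H1 :: "('v, 'e) pre_digraph \<Rightarrow> ('e \<Rightarrow>\<^sub>0 int) set" where
  "H1 G = {c. Poly_Mapping.keys c \<subseteq> arcs G \<and> boundary G c = 0}"

text \<open>
  The rank of a subgroup is the largest number of \<open>\<int>\<close>-linearly independent elements. For a
  subgroup of finite rank, as used here, the supremum is a maximum.
\<close>

definition frag_rank :: "('a \<Rightarrow>\<^sub>0 int) set \<Rightarrow> nat" where
  "frag_rank M = Sup (card ` {B. B \<subseteq> M \<and> finite B \<and> frag.independent B})"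

definition h1 :: "('v, 'e) pre_digraph \<Rightarrow> nat" where
  "h1 G = frag_rank (H1 G)"

definition frag_basis :: "('a \<Rightarrow>\<^sub>0 int) list \<Rightarrow> ('a \<Rightarrow>\<^sub>0 int) set \<Rightarrow> bool" where
  "frag_basis hs M \<longleftrightarrow> distinct hs \<and> frag.independent (set hs) \<and> frag.span (set hs) = M"

definition edge_subgraph :: "('v, 'e) pre_digraph \<Rightarrow> 'e set \<Rightarrow> ('v, 'e) pre_digraph" where
  "edge_subgraph G S = \<lparr>verts = tail G ` S \<union> head G ` S, arcs = S, tail = tail G, head = head G\<rparr>"

text \<open>
  Integral polynomials in variables indexed by \<open>'e\<close>: finitely supported maps from exponent
  vectors to coefficients, with the convolution product of \<^type>\<open>poly_mapping\<close>.
\<close>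

type_synonym 'e zpoly = "('e \<Rightarrow>\<^sub>0 nat) \<Rightarrow>\<^sub>0 int"

definition Var :: "'e \<Rightarrow> 'e zpoly" where
  "Var e = Poly_Mapping.single (Poly_Mapping.single e 1) 1"

definition eval_zpoly :: "'e zpoly \<Rightarrow> ('e \<Rightarrow> 'k::comm_ring_1) \<Rightarrow> 'k" where
  "eval_zpoly p x = (\<Sum>m\<in>Poly_Mapping.keys p.
     of_int (Poly_Mapping.lookup p m) *
     (\<Prod>e\<in>Poly_Mapping.keys m. x e ^ Poly_Mapping.lookup m e))"

text \<open>If \<open>hs\<close> is a basis of \<open>H1 G\<close>, this is the graph polynomial; it does not depend on the basis.\<close>

definition graph_polynomial ::
    "('v, 'e) pre_digraph \<Rightarrow> ('e \<Rightarrow>\<^sub>0 int) list \<Rightarrow> 'e zpoly" where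
  "graph_polynomial G hs = det (mat (length hs) (length hs) (\<lambda>(j, k).
     \<Sum>e\<in>arcs G. Var e *
       of_int (Poly_Mapping.lookup (hs ! j) e * Poly_Mapping.lookup (hs ! k) e)))"

text \<open>
  Projective space with homogeneous coordinates indexed by \<open>E\<close>. Vectors are functions vanishing
  outside \<open>E\<close>; a point is the set of all nonzero multiples of a nonzero vector.

  A projective variety over a field \<open>k\<close> is represented by its points over the algebraic closure of
  \<open>k\<close>. Note that \<open>coordinate_space E E\<close> is empty, and so is the hypersurface of the constant
  polynomial \<open>1\<close>, the graph polynomial of a tree. Hence for \<open>S = arcs G\<close> and \<open>G\<close> a tree, the
  coordinate space is contained in the graph hypersurface although \<open>h1 (edge_subgraph G S) = 0\<close>;
  the condition \<open>S \<noteq> arcs G \<or> 0 < h1 G\<close> excludes precisely this case.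
\<close>

definition proj_space :: "'e set \<Rightarrow> ('e \<Rightarrow> 'k::field) set set" where
  "proj_space E = {x. (\<forall>e. e \<notin> E \<longrightarrow> x e = 0) \<and> (\<exists>e. x e \<noteq> 0)} //
     {(x, y). \<exists>c. c \<noteq> 0 \<and> y = (\<lambda>e. c * x e)}"

definition proj_hypersurface :: "'e set \<Rightarrow> 'e zpoly \<Rightarrow> ('e \<Rightarrow> 'k::field) set set" where
  "proj_hypersurface E p = {P \<in> proj_space E. \<forall>x\<in>P. eval_zpoly p x = 0}"

definition coordinate_space :: "'e set \<Rightarrow> 'e set \<Rightarrow> ('e \<Rightarrow> 'k::field) set set" where
  "coordinate_space E S = {P \<in> proj_space E. \<forall>x\<in>P. \<forall>e\<in>S. x e = 0}"

definition graph_hypersurface ::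
    "('v, 'e) pre_digraph \<Rightarrow> ('e \<Rightarrow>\<^sub>0 int) list \<Rightarrow> ('e \<Rightarrow> 'k::field) set set" where
  "graph_hypersurface G hs = proj_hypersurface (arcs G) (graph_polynomial G hs)"

end

theory Submission
  imports Defs
begin

text \<open>
  On \<open>L\<close>, a nonzero cycle supported on \<open>S\<close> lies in the kernel of the Gram matrix; dividing its
  coordinates by their greatest common divisor keeps it nonzero in positive characteristic.
  Conversely, if no nonzero cycle is supported on \<open>S\<close>, enlarge \<open>S\<close> to a maximal set \<open>T\<close> with this
  property. The fundamental cycles of the edges outside \<open>T\<close> form a basis of the homology, in which
  the Gram matrix at the point with coordinates \<open>0\<close> on \<open>T\<close> and \<open>1\<close> off \<open>T\<close> is the identity.
  Hence the graph polynomial does not vanish there.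
\<close>

section \<open>Ranks of groups of cycles\<close>

text \<open>Gaussian elimination without division, one equation for each element of
  \<open>E\<close>: the pivot \<open>b0\<close> of the equation \<open>e\<close> is eliminated from
  the others by cross-multiplication.\<close>

lemma integer_relation_exists:
  fixes a :: "'b \<Rightarrow> 'e \<Rightarrow> int"
  assumes "finite E" "finite B" "card E < card B"
  shows "\<exists>n. (\<exists>b\<in>B. n b \<noteq> 0) \<and> (\<forall>e\<in>E. (\<Sum>b\<in>B. n b * a b e) = 0)"
  using assms
proof (induction E arbitrary: B a rule: finite_induct)
  case empty
  then have "B \<noteq> {}" by auto
  then show ?case by (intro exI[of _ "\<lambda>_. 1"]) auto
next
  case (insert e E)
  show ?case
  proof (cases "\<forall>b\<in>B. a b e = 0")
    case True
    obtain n where "\<exists>b\<in>B. n b \<noteq> 0" "\<forall>f\<in>E. (\<Sum>b\<in>B. n b * a b f) = 0"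
      using insert.IH[of B a] insert.prems insert.hyps by auto
    with True show ?thesis by (intro exI[of _ n]) auto
  next
    case False
    then obtain b0 where b0: "b0 \<in> B" "a b0 e \<noteq> 0" by blast
    define B' where "B' = B - {b0}"
    have B': "finite B'" "card E < card B'" "B' \<subseteq> B" "b0 \<notin> B'" "B = insert b0 B'"
      using insert b0 by (auto simp: B'_def)
    obtain n where n: "\<exists>b\<in>B'. n b \<noteq> 0"
      "\<forall>f\<in>E. (\<Sum>b\<in>B'. n b * (a b0 e * a b f - a b e * a b0 f)) = 0"
      using insert.IH[OF B'(1,2), of "\<lambda>b f. a b0 e * a b f - a b e * a b0 f"] by blast
    \<comment> \<open>The coefficient of \<open>b0\<close> is chosen to solve equation
      \<open>e\<close>; the factor \<open>a b0 e\<close> on the others clears denominators and keeps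
      nonzero coefficients nonzero.\<close>
    define m where "m b = (if b = b0 then - (\<Sum>b\<in>B'. n b * a b e) else a b0 e * n b)" for b
    have sum_m: "(\<Sum>b\<in>B. m b * a b f) = (\<Sum>b\<in>B'. n b * (a b0 e * a b f - a b e * a b0 f))" for f
    proof -
      have "(\<Sum>b\<in>B. m b * a b f) = m b0 * a b0 f + (\<Sum>b\<in>B'. m b * a b f)"
        using B' by simp
      also have "(\<Sum>b\<in>B'. m b * a b f) = (\<Sum>b\<in>B'. n b * (a b0 e * a b f))"
        using B'(4) by (intro sum.cong) (auto simp: m_def)
      also have "m b0 * a b0 f = - (\<Sum>b\<in>B'. n b * (a b e * a b0 f))"
        by (simp add: m_def sum_distrib_right mult.assoc)
      finally show ?thesis
        by (simp add: right_diff_distrib sum_subtractf)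
    qed
    have "\<exists>b\<in>B. m b \<noteq> 0"
      using n(1) B'(3,4) b0 by (auto simp: m_def)
    moreover have "\<forall>f\<in>insert e E. (\<Sum>b\<in>B. m b * a b f) = 0"
      unfolding sum_m using n(2) by (auto simp: mult.commute)
    ultimately show ?thesis by blast
  qed
qed

lemma lookup_H1_eq_0: "c \<in> H1 G \<Longrightarrow> e \<notin> arcs G \<Longrightarrow> Poly_Mapping.lookup c e = 0"
  by (auto simp: H1_def in_keys_iff)

text \<open>Bounds the set of cardinalities in \<open>frag_rank\<close>, so that its supremum is an
  upper bound.\<close>

lemma card_independent_H1_le:
  assumes "finite (arcs G)" "B \<subseteq> H1 G" "finite B" "frag.independent B"
  shows "card B \<le> card (arcs G)"
proof (rule ccontr)
  assume "\<not> ?thesis"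
  then obtain n where n: "\<exists>b\<in>B. n b \<noteq> 0"
    "\<forall>e\<in>arcs G. (\<Sum>b\<in>B. n b * Poly_Mapping.lookup b e) = 0"
    using integer_relation_exists[OF assms(1,3), of Poly_Mapping.lookup] by auto
  have "(\<Sum>b\<in>B. frag_cmul (n b) b) = 0"
  proof (rule poly_mapping_eqI)
    fix e
    have "(\<Sum>b\<in>B. n b * Poly_Mapping.lookup b e) = 0" if "e \<notin> arcs G"
      using assms(2) that by (intro sum.neutral) (auto simp: lookup_H1_eq_0)
    with n(2) show "Poly_Mapping.lookup (\<Sum>b\<in>B. frag_cmul (n b) b) e = Poly_Mapping.lookup 0 e"
      by (auto simp: lookup_sum)
  qed
  with n(1) assms(3) have "frag.dependent B"
    unfolding frag.dependent_explicit by blast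
  with assms(4) show False by simp
qed

text \<open>The free abelian group on the edges is torsion-free, so a single nonzero cycle already
  forms an independent set.\<close>

lemma h1_pos_iff:
  assumes "finite (arcs G)"
  shows "0 < h1 G \<longleftrightarrow> (\<exists>c\<in>H1 G. c \<noteq> 0)"
proof
  let ?X = "{B. B \<subseteq> H1 G \<and> finite B \<and> frag.independent B}"
  assume "0 < h1 G"
  show "\<exists>c\<in>H1 G. c \<noteq> 0"
  proof (rule ccontr)
    assume zero: "\<not> ?thesis"
    have "B = {}" if B: "B \<subseteq> H1 G" "frag.independent B" for B
    proof (rule ccontr)
      assume "B \<noteq> {}"
      then obtain c where "c \<in> B" by blast
      moreover from this have "c = 0" using zero B(1) by auto
      ultimately show False using B(2) frag.dependent_zero by metis
    qed
    then have "?X = {{}}"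
      using frag.independent_empty by (intro equalityI subsetI) simp_all
    then have "h1 G = 0"
      by (simp add: h1_def frag_rank_def)
    with \<open>0 < h1 G\<close> show False by simp
  qed
next
  let ?X = "{B. B \<subseteq> H1 G \<and> finite B \<and> frag.independent B}"
  assume "\<exists>c\<in>H1 G. c \<noteq> 0"
  then obtain c where c: "c \<in> H1 G" "c \<noteq> 0" by blast
  have "frag.independent {c}"
    using c(2) by (auto simp: frag.dependent_finite)
  then have "{c} \<in> ?X" using c by simp
  then have "card {c} \<in> card ` ?X" by blast
  moreover have "bdd_above (card ` ?X)"
    using card_independent_H1_le[OF assms] by (intro bdd_aboveI[of _ "card (arcs G)"]) auto
  ultimately have "card {c} \<le> h1 G"
    unfolding h1_def frag_rank_def by (intro cSup_upper)
  then show "0 < h1 G" by simp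
qed

text \<open>\<open>boundary\<close> is determined by heads and tails, which
  \<open>edge_subgraph\<close> keeps; only the condition on the support changes.\<close>

lemma H1_edge_subgraph:
  "S \<subseteq> arcs G \<Longrightarrow> H1 (edge_subgraph G S) = {c \<in> H1 G. Poly_Mapping.keys c \<subseteq> S}"
  by (auto simp: H1_def boundary_def edge_subgraph_def)

lemma frag_basis_coordinates:
  assumes "frag_basis hs M" "c \<in> M"
  shows "\<exists>n. c = (\<Sum>j<length hs. frag_cmul (n j) (hs ! j))"
proof -
  have "c \<in> frag.span (set hs)"
    using assms by (simp add: frag_basis_def)
  then obtain u where "c = (\<Sum>v\<in>set hs. frag_cmul (u v) v)"
    by (auto simp: frag.span_finite)
  also have "\<dots> = (\<Sum>j<length hs. frag_cmul (u (hs ! j)) (hs ! j))"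
    using assms(1)
    by (intro sum.reindex_bij_betw[symmetric] bij_betw_nth) (auto simp: frag_basis_def)
  finally show ?thesis by (intro exI[of _ "\<lambda>j. u (hs ! j)"])
qed

text \<open>Distinctness of \<open>hs\<close> matches positions with basis elements, so independence
  of the set carries over to coefficients indexed by position.\<close>

lemma frag_basis_relation:
  assumes "frag_basis hs M" "(\<Sum>j<length hs. frag_cmul (n j) (hs ! j)) = 0" "j < length hs"
  shows "n j = 0"
proof -
  have bij: "bij_betw ((!) hs) {..<length hs} (set hs)"
    using assms(1) by (intro bij_betw_nth) (auto simp: frag_basis_def)
  define u where "u v = n (the_inv_into {..<length hs} ((!) hs) v)" for v
  have u: "u (hs ! i) = n i" if "i < length hs" for i
    using bij that by (simp add: u_def the_inv_into_f_f bij_betw_def)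
  have "(\<Sum>v\<in>set hs. frag_cmul (u v) v) = (\<Sum>j<length hs. frag_cmul (u (hs ! j)) (hs ! j))"
    using bij by (rule sum.reindex_bij_betw[symmetric])
  also have "\<dots> = 0" using assms(2) by (simp add: u)
  finally have "\<forall>v\<in>set hs. u v = 0"
    using assms(1) by (auto simp: frag_basis_def frag.dependent_finite)
  then have "u (hs ! j) = 0"
    using assms(3) by simp
  then show ?thesis using u assms(3) by simp
qed

section \<open>Evaluation of the graph polynomial\<close>

lemma eval_zpoly_superset:
  assumes "finite K" "Poly_Mapping.keys p \<subseteq> K"
  shows "eval_zpoly p x = (\<Sum>m\<in>K. of_int (Poly_Mapping.lookup p m) *
     (\<Prod>e\<in>Poly_Mapping.keys m. x e ^ Poly_Mapping.lookup m e))"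
  unfolding eval_zpoly_def using assms
  by (intro sum.mono_neutral_left) (auto simp: in_keys_iff)

lemma eval_zpoly_zero: "eval_zpoly 0 x = 0"
  by (simp add: eval_zpoly_def)

lemma eval_zpoly_single:
  "eval_zpoly (Poly_Mapping.single m a) x =
     of_int a * (\<Prod>e\<in>Poly_Mapping.keys m. x e ^ Poly_Mapping.lookup m e)"
  by (subst eval_zpoly_superset[of "{m}"]) auto

lemma eval_zpoly_add: "eval_zpoly (p + q) x = eval_zpoly p x + eval_zpoly q x"
  using keys_add[of p q]
  by (simp add: eval_zpoly_superset[of "Poly_Mapping.keys p \<union> Poly_Mapping.keys q"]
      lookup_add sum.distrib[symmetric] distrib_right)

lemma eval_zpoly_diff: "eval_zpoly (p - q) x = eval_zpoly p x - eval_zpoly q x"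
  using eval_zpoly_add[of "p - q" q x] by simp

lemma eval_monomial_add:
  "(\<Prod>e\<in>Poly_Mapping.keys (m + n). x e ^ Poly_Mapping.lookup (m + n) e) =
   (\<Prod>e\<in>Poly_Mapping.keys m. x e ^ Poly_Mapping.lookup m e) *
   (\<Prod>e\<in>Poly_Mapping.keys n. (x e :: 'k::comm_ring_1) ^ Poly_Mapping.lookup n e)"
proof -
  let ?K = "Poly_Mapping.keys m \<union> Poly_Mapping.keys n"
  have *: "(\<Prod>e\<in>Poly_Mapping.keys l. x e ^ Poly_Mapping.lookup l e) =
    (\<Prod>e\<in>?K. x e ^ Poly_Mapping.lookup l e)" if "Poly_Mapping.keys l \<subseteq> ?K" for l
    using that by (intro prod.mono_neutral_left) (auto simp: in_keys_iff)
  show ?thesis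
    unfolding *[OF keys_add] *[OF Un_upper1] *[OF Un_upper2]
    by (simp add: lookup_add power_add prod.distrib)
qed

text \<open>Both sides are additive in each factor, so two nested inductions reduce the claim to a
  product of two monomials.\<close>

lemma eval_zpoly_mult: "eval_zpoly (p * q) x = eval_zpoly p x * eval_zpoly q x"
proof (induction p rule: frag_induction[OF subset_UNIV])
  case (2 m)
  show ?case
  proof (induction q rule: frag_induction[OF subset_UNIV])
    case (2 n)
    then show ?case by (simp add: mult_single eval_zpoly_single eval_monomial_add)
  qed (simp_all add: eval_zpoly_zero right_diff_distrib eval_zpoly_diff)
qed (simp_all add: eval_zpoly_zero left_diff_distrib eval_zpoly_diff)

lemma eval_zpoly_of_int: "eval_zpoly (of_int a) x = of_int a"
  using eval_zpoly_single[of 0 a x] by (simp add: single_of_int[symmetric] del: single_of_int)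

lemma eval_zpoly_Var: "eval_zpoly (Var e) x = x e"
  by (simp add: Var_def eval_zpoly_single)

lemma comm_ring_hom_eval_zpoly: "comm_ring_hom (\<lambda>p. eval_zpoly p x)"
proof
  show "eval_zpoly 1 x = 1" using eval_zpoly_of_int[of 1 x] by simp
qed (rule eval_zpoly_zero eval_zpoly_add eval_zpoly_mult)+

text \<open>The ring is left general: \<open>x = Var\<close> gives the matrix defining the graph
  polynomial, and a point \<open>x\<close> over a field gives its specialization.\<close>

definition cycle_gram_mat ::
    "'e set \<Rightarrow> ('e \<Rightarrow>\<^sub>0 int) list \<Rightarrow> ('e \<Rightarrow> 'k::comm_ring_1) \<Rightarrow> 'k mat" where
  "cycle_gram_mat E hs x = mat (length hs) (length hs) (\<lambda>(j, k).
     \<Sum>e\<in>E. x e * of_int (Poly_Mapping.lookup (hs ! j) e * Poly_Mapping.lookup (hs ! k) e))"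

lemma cycle_gram_mat_carrier: "cycle_gram_mat E hs x \<in> carrier_mat (length hs) (length hs)"
  by (simp add: cycle_gram_mat_def)

lemma eval_graph_polynomial:
  "eval_zpoly (graph_polynomial G hs) x = det (cycle_gram_mat (arcs G) hs x)"
proof -
  interpret ev: comm_ring_hom "\<lambda>p. eval_zpoly p x" by (rule comm_ring_hom_eval_zpoly)
  have "map_mat (\<lambda>p. eval_zpoly p x) (cycle_gram_mat (arcs G) hs Var) =
    cycle_gram_mat (arcs G) hs x"
    by (intro eq_matI)
      (simp_all add: cycle_gram_mat_def ev.hom_sum eval_zpoly_mult eval_zpoly_of_int
        eval_zpoly_Var del: of_int_mult)
  moreover have "graph_polynomial G hs = det (cycle_gram_mat (arcs G) hs Var)"
    by (simp add: graph_polynomial_def cycle_gram_mat_def)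
  ultimately show ?thesis
    by (simp flip: ev.hom_det)
qed


section \<open>The hypersurface contains the coordinate space of a set with a cycle\<close>

text \<open>Nonzero integers may all vanish modulo the characteristic; after division by their
  greatest common divisor at least one survives.\<close>

lemma Gcd_factorization_of_int_nonzero:
  fixes n :: "'a \<Rightarrow> int"
  assumes "\<exists>j\<in>J. n j \<noteq> 0"
  shows "\<exists>g m. g \<noteq> 0 \<and> (\<forall>j\<in>J. n j = g * m j) \<and> (\<exists>j\<in>J. (of_int (m j) :: 'k::idom) \<noteq> 0)"
proof -
  define g where "g = Gcd (n ` J)"
  define m where "m j = n j div g" for j
  have g: "g \<noteq> 0" using assms by (auto simp: g_def Gcd_0_iff)
  have nm: "n j = g * m j" if "j \<in> J" for j
    using that by (simp add: m_def g_def)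
  have "n ` J = (*) g ` (m ` J)"
    unfolding image_image using nm by (intro image_cong) auto
  then have "g = normalize (g * Gcd (m ` J))"
    using Gcd_mult[of g "m ` J"] by (simp add: g_def)
  moreover have "0 \<le> g * Gcd (m ` J)" by (simp add: g_def)
  ultimately have Gcd1: "Gcd (m ` J) = 1"
    using g by simp
  have "\<exists>j\<in>J. (of_int (m j) :: 'k) \<noteq> 0"
  proof (rule ccontr)
    assume "\<not> ?thesis"
    \<comment> \<open>This also covers characteristic zero, as \<open>0\<close> does not divide
      \<open>1\<close>; and \<open>CHAR('k)\<close> is never \<open>1\<close>.\<close>
    then have "int CHAR('k) dvd Gcd (m ` J)"
      by (intro Gcd_greatest) (auto simp: of_int_eq_0_iff_char_dvd)
    with Gcd1 show False by simp
  qed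
  with g nm show ?thesis
    by (intro exI[of _ g] exI[of _ m] conjI ballI)
qed

lemma det_cycle_gram_mat_eq_0:
  fixes x :: "'e \<Rightarrow> 'k::field"
  assumes basis: "frag_basis hs (H1 G)" and c: "c \<in> H1 G" "c \<noteq> 0"
    and orth: "\<And>e. e \<in> arcs G \<Longrightarrow> x e = 0 \<or> Poly_Mapping.lookup c e = 0"
  shows "det (cycle_gram_mat (arcs G) hs x) = 0"
proof -
  let ?d = "length hs"
  obtain n where n: "c = (\<Sum>j<?d. frag_cmul (n j) (hs ! j))"
    using frag_basis_coordinates[OF basis c(1)] by blast
  have "\<exists>j\<in>{..<?d}. n j \<noteq> 0"
    using c(2) n by (metis (mono_tags, lifting) frag_cmul_zero sum.neutral)
  then obtain g m where g: "g \<noteq> 0" and nm: "\<And>j. j < ?d \<Longrightarrow> n j = g * m j"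
    and m: "\<exists>j<?d. (of_int (m j) :: 'k) \<noteq> 0"
    using Gcd_factorization_of_int_nonzero[of "{..<?d}" n] by (metis lessThan_iff)
  have "c = frag_cmul g (\<Sum>j<?d. frag_cmul (m j) (hs ! j))"
    unfolding n frag_cmul_sum by (intro sum.cong) (auto simp: nm)
  then have "Poly_Mapping.lookup c e = g * (\<Sum>j<?d. m j * Poly_Mapping.lookup (hs ! j) e)" for e
    by (simp add: lookup_sum)
  \<comment> \<open>The factor \<open>g\<close> is cancelled over the integers, since it may become
    zero in \<open>'k\<close>.\<close>
  then have lc: "x e = 0 \<or> (\<Sum>j<?d. m j * Poly_Mapping.lookup (hs ! j) e) = 0"
    if "e \<in> arcs G" for e
    using orth[OF that] g by simp
  define v where "v = vec ?d (\<lambda>j. of_int (m j) :: 'k)"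
  have "cycle_gram_mat (arcs G) hs x *\<^sub>v v = 0\<^sub>v ?d"
  proof (rule eq_vecI)
    fix i assume "i < dim_vec (0\<^sub>v ?d :: 'k vec)"
    then have i: "i < ?d" by simp
    have "(cycle_gram_mat (arcs G) hs x *\<^sub>v v) $ i =
      (\<Sum>k<?d. (\<Sum>e\<in>arcs G. x e * of_int (Poly_Mapping.lookup (hs ! i) e *
        Poly_Mapping.lookup (hs ! k) e)) * of_int (m k))"
      using i by (simp add: cycle_gram_mat_def v_def scalar_prod_def atLeast0LessThan)
    also have "\<dots> = (\<Sum>e\<in>arcs G. \<Sum>k<?d. x e * of_int (Poly_Mapping.lookup (hs ! i) e *
        Poly_Mapping.lookup (hs ! k) e) * of_int (m k))"
      unfolding sum_distrib_right by (rule sum.swap)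
    \<comment> \<open>The inner sum is now the coordinate at \<open>e\<close> of \<open>c\<close>
      divided by \<open>g\<close>, which vanishes wherever \<open>x e\<close> does not.\<close>
    also have "\<dots> = (\<Sum>e\<in>arcs G. x e * of_int (Poly_Mapping.lookup (hs ! i) e) *
        of_int (\<Sum>k<?d. m k * Poly_Mapping.lookup (hs ! k) e))"
      by (simp add: sum_distrib_left mult_ac)
    also have "\<dots> = 0"
    proof (intro sum.neutral ballI)
      fix e assume "e \<in> arcs G"
      from lc[OF this] show "x e * of_int (Poly_Mapping.lookup (hs ! i) e) *
          of_int (\<Sum>k<?d. m k * Poly_Mapping.lookup (hs ! k) e) = 0"
        by (elim disjE) (simp_all only: of_int_0 mult_zero_left mult_zero_right)
    qed
    finally show "(cycle_gram_mat (arcs G) hs x *\<^sub>v v) $ i = 0\<^sub>v ?d $ i"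
      using i by simp
  qed (simp add: cycle_gram_mat_def)
  moreover have "v \<in> carrier_vec ?d"
    by (simp add: v_def)
  moreover have "v \<noteq> 0\<^sub>v ?d"
  proof
    assume "v = 0\<^sub>v ?d"
    then have "v $ j = 0" if "j < ?d" for j
      using that by simp
    with m show False by (auto simp: v_def)
  qed
  ultimately show ?thesis
    using det_0_iff_vec_prod_zero_field[OF cycle_gram_mat_carrier] by blast
qed

section \<open>A point off the hypersurface for a set without cycles\<close>

lemma H1_diff: "c \<in> H1 G \<Longrightarrow> c' \<in> H1 G \<Longrightarrow> c - c' \<in> H1 G"
  using keys_diff[of c c'] by (auto simp: H1_def boundary_def frag_extend_diff)

lemma H1_cmul: "c \<in> H1 G \<Longrightarrow> frag_cmul a c \<in> H1 G"
  by (auto simp: H1_def boundary_def frag_extend_cmul)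

lemma H1_sum: "(\<And>i. i \<in> I \<Longrightarrow> f i \<in> H1 G) \<Longrightarrow> sum f I \<in> H1 G"
proof (induction I rule: infinite_finite_induct)
  case (insert i I)
  then have "f i \<in> H1 G" "sum f I \<in> H1 G" by auto
  then show ?case
    using insert.hyps keys_add[of "f i" "sum f I"]
    by (auto simp: H1_def boundary_def frag_extend_add)
qed (auto simp: H1_def boundary_def)

text \<open>
  Otherwise the vertices joined to the tail of \<open>e\<close> by a chain in \<open>T\<close> form a set that \<open>e\<close> alone
  leaves, and the boundary of \<open>c\<close> summed over this set is \<open>- c e \<noteq> 0\<close>.
\<close>

lemma fundamental_cycle_exists:
  assumes "T \<subseteq> arcs G" "e \<in> arcs G" "e \<notin> T"
    and c: "c \<in> H1 G" "Poly_Mapping.keys c \<subseteq> insert e T" "Poly_Mapping.lookup c e \<noteq> 0"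
  shows "\<exists>z\<in>H1 G. Poly_Mapping.keys z \<subseteq> insert e T \<and> Poly_Mapping.lookup z e = 1"
proof -
  define U where "U = {w. \<exists>p. Poly_Mapping.keys p \<subseteq> T \<and>
    boundary G p = frag_of w - frag_of (tail G e)}"
  have tail_U: "tail G e \<in> U"
    unfolding U_def by (auto simp: boundary_def intro!: exI[of _ 0])
  have edge_U: "head G f \<in> U \<longleftrightarrow> tail G f \<in> U" if f: "f \<in> T" for f
  proof
    assume "head G f \<in> U"
    then obtain p where "Poly_Mapping.keys p \<subseteq> T"
      "boundary G p = frag_of (head G f) - frag_of (tail G e)" by (auto simp: U_def)
    then show "tail G f \<in> U"
      using f keys_diff[of p "frag_of f"] unfolding U_def
      by (auto simp: boundary_def frag_extend_diff intro!: exI[of _ "p - frag_of f"])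
  next
    assume "tail G f \<in> U"
    then obtain p where "Poly_Mapping.keys p \<subseteq> T"
      "boundary G p = frag_of (tail G f) - frag_of (tail G e)" by (auto simp: U_def)
    then show "head G f \<in> U"
      using f keys_add[of p "frag_of f"] unfolding U_def
      by (auto simp: boundary_def frag_extend_add intro!: exI[of _ "p + frag_of f"])
  qed
  have "head G e \<in> U"
  proof (rule ccontr)
    assume head_U: "head G e \<notin> U"
    \<comment> \<open>The indicator of \<open>U\<close> with values in a free group of rank one, so
      that \<open>frag_extend ind\<close> sums the coefficients of a 0-chain over
      \<open>U\<close>.\<close>
    define ind where "ind w = (if w \<in> U then frag_of () else 0)" for w
    have "frag_extend ind (boundary G b) = frag_extend (\<lambda>f. ind (head G f) - ind (tail G f)) b" for b
      by (induction b rule: frag_induction[OF subset_UNIV])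
        (simp_all add: boundary_def frag_extend_diff)
    then have "0 = frag_extend (\<lambda>f. ind (head G f) - ind (tail G f)) c"
      using c(1) by (metis (mono_tags, lifting) H1_def frag_extend_0 mem_Collect_eq)
    \<comment> \<open>An edge of \<open>T\<close> has both ends in \<open>U\<close> or neither, so
      only \<open>e\<close> contributes.\<close>
    also have "\<dots> = (\<Sum>f\<in>{e}. frag_cmul (Poly_Mapping.lookup c f) (ind (head G f) - ind (tail G f)))"
      unfolding frag_extend_def using c(2,3) edge_U
      by (intro sum.mono_neutral_right) (auto simp: in_keys_iff ind_def)
    also have "\<dots> = frag_cmul (Poly_Mapping.lookup c e) (0 - frag_of ())"
      using head_U tail_U by (simp only: ind_def if_True if_False sum.insert sum.empty
          finite.emptyI empty_iff not_False_eq_True add_0_right)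
    finally show False
      using c(3) by (metis diff_0 frag_cmul_eq_0_iff frag_of_nonzero neg_equal_0_iff_equal)
  qed
  then obtain p where p: "Poly_Mapping.keys p \<subseteq> T"
    "boundary G p = frag_of (head G e) - frag_of (tail G e)" by (auto simp: U_def)
  \<comment> \<open>The chain \<open>p\<close> in \<open>T\<close> has the same boundary as
    \<open>e\<close>, so the difference is a cycle, with coefficient exactly \<open>1\<close> at
    \<open>e\<close>.\<close>
  have "Poly_Mapping.keys (frag_of e - p) \<subseteq> insert e T"
    using keys_diff[of "frag_of e" p] p(1) by auto
  moreover from this have "frag_of e - p \<in> H1 G"
    using assms(1,2) p(2) by (auto simp: H1_def boundary_def frag_extend_diff)
  moreover have "Poly_Mapping.lookup p e = 0"
    using p(1) assms(3) by (auto simp: in_keys_iff)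
  then have "Poly_Mapping.lookup (frag_of e - p) e = 1"
    by (simp add: lookup_minus)
  ultimately show ?thesis by blast
qed

text \<open>These are the forests, that is, the independent sets of the cycle matroid, described by
  homology instead of paths.\<close>

definition acyclic_edges :: "('v, 'e) pre_digraph \<Rightarrow> 'e set \<Rightarrow> bool" where
  "acyclic_edges G T \<longleftrightarrow> T \<subseteq> arcs G \<and> (\<forall>c\<in>H1 G. Poly_Mapping.keys c \<subseteq> T \<longrightarrow> c = 0)"

text \<open>A maximal acyclic set is a spanning forest: adding \<open>e\<close> creates a nonzero
  cycle, which must pass through \<open>e\<close> and so yields a fundamental cycle of
  \<open>e\<close>.\<close>

lemma acyclic_edges_extend_to_maximal:
  assumes "finite (arcs G)" "acyclic_edges G S"
  shows "\<exists>T. S \<subseteq> T \<and> acyclic_edges G T \<and> (\<forall>e\<in>arcs G - T. \<exists>z\<in>H1 G.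
    Poly_Mapping.keys z \<subseteq> insert e T \<and> Poly_Mapping.lookup z e = 1)"
proof -
  have "finite (Collect (acyclic_edges G))"
    by (rule finite_subset[of _ "Pow (arcs G)"]) (use assms(1) in \<open>auto simp: acyclic_edges_def\<close>)
  then obtain T where T: "acyclic_edges G T" "S \<subseteq> T"
    and max: "\<And>T'. acyclic_edges G T' \<Longrightarrow> T \<subseteq> T' \<Longrightarrow> T = T'"
    using finite_has_maximal2[of "Collect (acyclic_edges G)" S] assms(2) by auto
  have "\<exists>z\<in>H1 G. Poly_Mapping.keys z \<subseteq> insert e T \<and> Poly_Mapping.lookup z e = 1"
    if e: "e \<in> arcs G - T" for e
  proof -
    have "\<not> acyclic_edges G (insert e T)"
      using max[of "insert e T"] e by blast
    then obtain c where c: "c \<in> H1 G" "Poly_Mapping.keys c \<subseteq> insert e T" "c \<noteq> 0"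
      using T(1) e by (auto simp: acyclic_edges_def)
    have "Poly_Mapping.lookup c e \<noteq> 0"
    proof
      assume "Poly_Mapping.lookup c e = 0"
      then have "Poly_Mapping.keys c \<subseteq> T"
        using c(2) by (auto simp: in_keys_iff)
      with c T(1) show False by (auto simp: acyclic_edges_def)
    qed
    with c e T(1) show ?thesis
      by (intro fundamental_cycle_exists) (auto simp: acyclic_edges_def)
  qed
  with T show ?thesis by blast
qed

text \<open>
  If \<open>P\<close> is the matrix of the \<open>hs ! j\<close> restricted to the edges outside \<open>T\<close>, then the Gram matrix
  is \<open>P\<^sup>T P\<close>. The fundamental cycles give a two-sided inverse \<open>B\<close> of \<open>P\<close>, so \<open>B B\<^sup>T\<close> is an
  inverse of the Gram matrix over the integers, hence over every field.
\<close>

lemma det_cycle_gram_mat_complement_nonzero: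
  fixes x :: "'e \<Rightarrow> 'k::field"
  assumes fin: "finite (arcs G)" and basis: "frag_basis hs (H1 G)" and T: "acyclic_edges G T"
    and cycles: "\<forall>e\<in>arcs G - T. \<exists>z\<in>H1 G.
      Poly_Mapping.keys z \<subseteq> insert e T \<and> Poly_Mapping.lookup z e = 1"
    and x: "\<And>e. e \<in> arcs G \<Longrightarrow> x e = (if e \<in> T then 0 else 1)"
  shows "det (cycle_gram_mat (arcs G) hs x) \<noteq> 0"
proof -
  let ?d = "length hs"
  define F where "F = arcs G - T"
  define P where "P e j = Poly_Mapping.lookup (hs ! j) e" for e j
  have finF: "finite F" using fin by (simp add: F_def)
  have "\<forall>e\<in>F. \<exists>z. z \<in> H1 G \<and> Poly_Mapping.keys z \<subseteq> insert e T \<and> Poly_Mapping.lookup z e = 1"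
    using cycles by (auto simp: F_def)
  from bchoice[OF this] obtain z where z: "z e \<in> H1 G" "Poly_Mapping.keys (z e) \<subseteq> insert e T"
    "Poly_Mapping.lookup (z e) e = 1" if "e \<in> F" for e
    by auto
  have z_F: "Poly_Mapping.lookup (z e) f = (if e = f then 1 else 0)" if "e \<in> F" "f \<in> F" for e f
    using z[OF that(1)] that(2) by (auto simp: F_def in_keys_iff)
  have "\<forall>e\<in>F. \<exists>n. z e = (\<Sum>j<?d. frag_cmul (n j) (hs ! j))"
    using frag_basis_coordinates[OF basis] z(1) by blast
  from bchoice[OF this] obtain B where B: "z e = (\<Sum>j<?d. frag_cmul (B e j) (hs ! j))"
    if "e \<in> F" for e
    by auto
  \<comment> \<open>Both sides are the coordinate at \<open>e\<close> of \<open>z f\<close>. As a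
    matrix, \<open>B\<close> has the entry \<open>B f k\<close> in row \<open>k\<close> and column
    \<open>f\<close>.\<close>
  have BP: "(\<Sum>k<?d. P e k * B f k) = (if e = f then 1 else 0)" if "e \<in> F" "f \<in> F" for e f
    using z_F[OF that(2,1)] by (simp add: B[OF that(2)] lookup_sum P_def mult.commute)
  have PB: "(\<Sum>e\<in>F. P e j * B e l) = (if j = l then 1 else 0)" if jl: "j < ?d" "l < ?d" for j l
  proof -
    \<comment> \<open>Subtracting fundamental cycles with the coefficients of \<open>hs ! j\<close>
      off \<open>T\<close> leaves a cycle supported on the acyclic set \<open>T\<close>, hence zero;
      comparing coordinates in \<open>hs\<close> then gives the identity.\<close>
    let ?r = "hs ! j - (\<Sum>e\<in>F. frag_cmul (P e j) (z e))"
    have "hs ! j \<in> H1 G"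
      using basis jl frag.span_base[of "hs ! j" "set hs"] by (simp add: frag_basis_def)
    then have r: "?r \<in> H1 G"
      using z(1) by (intro H1_diff H1_sum H1_cmul)
    have "Poly_Mapping.lookup ?r f = 0" if "f \<in> F" for f
    proof -
      have "Poly_Mapping.lookup ?r f = P f j - (\<Sum>e\<in>F. P e j * Poly_Mapping.lookup (z e) f)"
        by (simp add: lookup_minus lookup_sum P_def)
      also have "(\<Sum>e\<in>F. P e j * Poly_Mapping.lookup (z e) f) =
          (\<Sum>e\<in>F. if e = f then P e j else 0)"
        using z_F that by (intro sum.cong) auto
      finally show ?thesis using finF that by simp
    qed
    then have "Poly_Mapping.keys ?r \<subseteq> T"
      using r lookup_H1_eq_0[OF r] by (force simp: F_def in_keys_iff)
    with r T have "?r = 0" by (auto simp: acyclic_edges_def)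
    then have "hs ! j = (\<Sum>e\<in>F. frag_cmul (P e j) (z e))" by simp
    also have "\<dots> = (\<Sum>e\<in>F. \<Sum>k<?d. frag_cmul (P e j * B e k) (hs ! k))"
      by (intro sum.cong) (simp_all add: B frag_cmul_sum)
    also have "\<dots> = (\<Sum>k<?d. \<Sum>e\<in>F. frag_cmul (P e j * B e k) (hs ! k))"
      by (rule sum.swap)
    also have "\<dots> = (\<Sum>k<?d. frag_cmul (\<Sum>e\<in>F. P e j * B e k) (hs ! k))"
      by (simp add: frag.scale_sum_left)
    finally have h: "hs ! j = (\<Sum>k<?d. frag_cmul (\<Sum>e\<in>F. P e j * B e k) (hs ! k))" .
    have "(\<Sum>k<?d. frag_cmul (if j = k then 1 else 0) (hs ! k)) =
        (\<Sum>k<?d. if j = k then hs ! k else 0)"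
      by (intro sum.cong) auto
    then have "(\<Sum>k<?d. frag_cmul (if j = k then 1 else 0) (hs ! k)) = hs ! j"
      using jl by simp
    with h have "(\<Sum>k<?d. frag_cmul ((\<Sum>e\<in>F. P e j * B e k) - (if j = k then 1 else 0)) (hs ! k)) = 0"
      by (simp add: frag_cmul_diff_distrib sum_subtractf)
    from frag_basis_relation[OF basis this jl(2)] show ?thesis by simp
  qed
  define M where "M = mat ?d ?d (\<lambda>(j, k). \<Sum>e\<in>F. P e j * P e k)"
  define N where "N = mat ?d ?d (\<lambda>(k, l). \<Sum>f\<in>F. B f k * B f l)"
  have MN: "M \<in> carrier_mat ?d ?d" "N \<in> carrier_mat ?d ?d"
    by (simp_all add: M_def N_def)
  have "M * N = 1\<^sub>m ?d"
  proof (rule eq_matI)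
    fix j l assume "j < dim_row (1\<^sub>m ?d :: int mat)" "l < dim_col (1\<^sub>m ?d :: int mat)"
    then have jl: "j < ?d" "l < ?d" by simp_all
    have "(M * N) $$ (j, l) =
        (\<Sum>k<?d. (\<Sum>e\<in>F. P e j * P e k) * (\<Sum>f\<in>F. B f k * B f l))"
      using jl by (simp add: M_def N_def scalar_prod_def atLeast0LessThan)
    \<comment> \<open>The sum over \<open>k\<close> is moved inside to apply \<open>BP\<close>; the
      sum over \<open>F\<close> that remains is the one in \<open>PB\<close>.\<close>
    also have "\<dots> = (\<Sum>k<?d. \<Sum>e\<in>F. \<Sum>f\<in>F. (P e j * P e k) * (B f k * B f l))"
      by (simp add: sum_product)
    also have "\<dots> = (\<Sum>e\<in>F. \<Sum>k<?d. \<Sum>f\<in>F. (P e j * P e k) * (B f k * B f l))"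
      by (rule sum.swap)
    also have "\<dots> = (\<Sum>e\<in>F. \<Sum>f\<in>F. \<Sum>k<?d. (P e j * P e k) * (B f k * B f l))"
      by (intro sum.cong refl sum.swap)
    also have "\<dots> = (\<Sum>e\<in>F. \<Sum>f\<in>F. P e j * B f l * (\<Sum>k<?d. P e k * B f k))"
      by (simp add: sum_distrib_left mult_ac)
    also have "\<dots> = (\<Sum>e\<in>F. \<Sum>f\<in>F. if e = f then P e j * B f l else 0)"
      by (intro sum.cong) (auto simp: BP)
    also have "\<dots> = (\<Sum>e\<in>F. P e j * B e l)"
      using finF by simp
    finally show "(M * N) $$ (j, l) = 1\<^sub>m ?d $$ (j, l)"
      using PB jl by simp
  qed (simp_all add: M_def N_def)
  then have "det M * det N = 1"
    using det_mult[OF MN] by simp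
  \<comment> \<open>\<open>det M\<close> is a unit of the integers, so its image is nonzero in every
    characteristic.\<close>
  then have "(of_int (det M) :: 'k) * of_int (det N) = 1"
    by (simp flip: of_int_mult)
  moreover have "cycle_gram_mat (arcs G) hs x = map_mat of_int M"
  proof (rule eq_matI)
    fix j k assume "j < dim_row (map_mat of_int M :: 'k mat)" "k < dim_col (map_mat of_int M :: 'k mat)"
    then have jk: "j < ?d" "k < ?d" by (simp_all add: M_def)
    have "(\<Sum>e\<in>arcs G. x e * of_int (P e j * P e k)) = (\<Sum>e\<in>F. of_int (P e j * P e k))"
      using fin x by (intro sum.mono_neutral_cong_right) (auto simp: F_def)
    with jk show "cycle_gram_mat (arcs G) hs x $$ (j, k) = map_mat of_int M $$ (j, k)"
      by (simp add: cycle_gram_mat_def M_def P_def)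
  qed (simp_all add: cycle_gram_mat_def M_def)
  ultimately show ?thesis by (auto simp: of_int_hom.hom_det)
qed

section \<open>From projective points to representing vectors, and the theorem\<close>

lemma coordinate_space_subset_hypersurface_iff:
  "coordinate_space E S \<subseteq> (proj_hypersurface E p :: ('e \<Rightarrow> 'k::field) set set) \<longleftrightarrow>
   (\<forall>x :: 'e \<Rightarrow> 'k. (\<forall>e. e \<notin> E \<longrightarrow> x e = 0) \<longrightarrow> (\<exists>e. x e \<noteq> 0) \<longrightarrow> (\<forall>e\<in>S. x e = 0) \<longrightarrow>
     eval_zpoly p x = 0)"
proof (intro iffI allI impI)
  fix x :: "'e \<Rightarrow> 'k"
  let ?R = "{(x, y). \<exists>c :: 'k. c \<noteq> 0 \<and> y = (\<lambda>e. c * x e)}"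
  assume sub: "coordinate_space E S \<subseteq> (proj_hypersurface E p :: ('e \<Rightarrow> 'k) set set)"
    and x: "\<forall>e. e \<notin> E \<longrightarrow> x e = 0" "\<exists>e. x e \<noteq> 0" "\<forall>e\<in>S. x e = 0"
  have "?R `` {x} \<in> proj_space E"
    unfolding proj_space_def using x(1,2) by (intro quotientI) simp
  then have "?R `` {x} \<in> coordinate_space E S"
    using x(3) by (auto simp: coordinate_space_def)
  with sub have "?R `` {x} \<in> proj_hypersurface E p" by blast
  moreover have "x \<in> ?R `` {x}" by (auto intro!: exI[of _ 1])
  ultimately show "eval_zpoly p x = 0" by (simp add: proj_hypersurface_def)
next
  assume *: "\<forall>x :: 'e \<Rightarrow> 'k. (\<forall>e. e \<notin> E \<longrightarrow> x e = 0) \<longrightarrow> (\<exists>e. x e \<noteq> 0) \<longrightarrow>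
    (\<forall>e\<in>S. x e = 0) \<longrightarrow> eval_zpoly p x = 0"
  show "coordinate_space E S \<subseteq> (proj_hypersurface E p :: ('e \<Rightarrow> 'k) set set)"
  proof
    fix A :: "('e \<Rightarrow> 'k) set"
    assume A: "A \<in> coordinate_space E S"
    have "eval_zpoly p x = 0" if "x \<in> A" for x
    proof -
      \<comment> \<open>Members of a class are nonzero multiples of a representative, so they are
        again nonzero vectors supported on \<open>E\<close>.\<close>
      have "(\<forall>e. e \<notin> E \<longrightarrow> x e = 0) \<and> (\<exists>e. x e \<noteq> 0)"
        using A that by (auto simp: coordinate_space_def proj_space_def elim!: quotientE)
      moreover have "\<forall>e\<in>S. x e = 0" using A that by (simp add: coordinate_space_def)
      ultimately show ?thesis using * by blast
    qed
    with A show "A \<in> proj_hypersurface E p"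
      by (simp add: coordinate_space_def proj_hypersurface_def)
  qed
qed

theorem proposition3p1:
  fixes G :: "('v, 'e) pre_digraph"
    and hs :: "('e \<Rightarrow>\<^sub>0 int) list"
    and S :: "'e set"
    and L XG :: "('e \<Rightarrow> 'k::field alg_closure) set set"
  assumes "fin_digraph G"
    and "Digraph_Component.connected G"
    and "frag_basis hs (H1 G)"
    and "XG = graph_hypersurface G hs"
    and "S \<subseteq> arcs G"
    and "L = coordinate_space (arcs G) S"
    and nondegenerate: "S \<noteq> arcs G \<or> 0 < h1 G"
  shows "L \<subseteq> XG \<longleftrightarrow> 0 < h1 (edge_subgraph G S)"
proof -
  have fin: "finite (arcs G)" using assms(1) by (rule fin_digraph.finite_arcs)
  note basis = assms(3)
  have "finite (arcs (edge_subgraph G S))"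
    using fin assms(5) finite_subset by (auto simp: edge_subgraph_def)
  then have pos: "0 < h1 (edge_subgraph G S) \<longleftrightarrow> \<not> acyclic_edges G S"
    using assms(5) by (auto simp: h1_pos_iff H1_edge_subgraph acyclic_edges_def)
  have sub: "L \<subseteq> XG \<longleftrightarrow> (\<forall>x :: 'e \<Rightarrow> 'k alg_closure. (\<forall>e. e \<notin> arcs G \<longrightarrow> x e = 0) \<longrightarrow>
      (\<exists>e. x e \<noteq> 0) \<longrightarrow> (\<forall>e\<in>S. x e = 0) \<longrightarrow> det (cycle_gram_mat (arcs G) hs x) = 0)"
    unfolding assms(4,6) graph_hypersurface_def coordinate_space_subset_hypersurface_iff
      eval_graph_polynomial by (rule refl)
  show ?thesis unfolding pos
  proof
    assume "\<not> acyclic_edges G S"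
    then obtain c where c: "c \<in> H1 G" "c \<noteq> 0" "Poly_Mapping.keys c \<subseteq> S"
      using assms(5) by (auto simp: acyclic_edges_def)
    show "L \<subseteq> XG" unfolding sub
    proof (intro allI impI)
      fix x :: "'e \<Rightarrow> 'k alg_closure"
      assume "\<forall>e\<in>S. x e = 0"
      with c(3) have "x e = 0 \<or> Poly_Mapping.lookup c e = 0" for e
        by (auto simp: in_keys_iff)
      with basis c(1,2) show "det (cycle_gram_mat (arcs G) hs x) = 0"
        by (rule det_cycle_gram_mat_eq_0)
    qed
  next
    assume "L \<subseteq> XG"
    show "\<not> acyclic_edges G S"
    proof
      assume "acyclic_edges G S"
      then obtain T where T: "S \<subseteq> T" "acyclic_edges G T"
        and cycles: "\<forall>e\<in>arcs G - T. \<exists>z\<in>H1 G.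
          Poly_Mapping.keys z \<subseteq> insert e T \<and> Poly_Mapping.lookup z e = 1"
        using acyclic_edges_extend_to_maximal[OF fin] by blast
      show False
      \<comment> \<open>If \<open>T\<close> contains all edges, the vector that is \<open>1\<close>
        off \<open>T\<close> is zero and represents no point.\<close>
      proof (cases "T = arcs G")
        case False
        define x where "x e = (if e \<in> arcs G - T then 1 else 0 :: 'k alg_closure)" for e
        have "det (cycle_gram_mat (arcs G) hs x) \<noteq> 0"
          by (rule det_cycle_gram_mat_complement_nonzero[OF fin basis T(2) cycles])
            (simp add: x_def)
        moreover have "\<exists>e. x e \<noteq> 0" "\<forall>e. e \<notin> arcs G \<longrightarrow> x e = 0" "\<forall>e\<in>S. x e = 0"
          using False T by (auto simp: x_def acyclic_edges_def)
        ultimately show False using \<open>L \<subseteq> XG\<close> sub by blast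
      next
        case True
        \<comment> \<open>There are no nonzero cycles, so the determinant is that of the empty
          matrix, \<open>1\<close>, and any point of \<open>L\<close> gives a contradiction;
          \<open>nondegenerate\<close> leaves an edge outside \<open>S\<close> to build one.\<close>
        have H1: "c = 0" if "c \<in> H1 G" for c
          using that T(2) True by (auto simp: acyclic_edges_def H1_def)
        then have "S \<noteq> arcs G"
          using nondegenerate fin by (auto simp: h1_pos_iff)
        define x where "x e = (if e \<in> arcs G - S then 1 else 0 :: 'k alg_closure)" for e
        have "hs = []"
        proof (rule ccontr)
          assume "hs \<noteq> []"
          then have "hd hs \<in> set hs" by simp
          moreover from this have "hd hs = 0"
            using basis frag.span_base H1 by (auto simp: frag_basis_def)
          ultimately show False
            using basis frag.dependent_zero by (auto simp: frag_basis_def)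
        qed
        then have "det (cycle_gram_mat (arcs G) hs x) \<noteq> 0"
          by (simp add: cycle_gram_mat_def)
        moreover have "\<exists>e. x e \<noteq> 0" "\<forall>e. e \<notin> arcs G \<longrightarrow> x e = 0" "\<forall>e\<in>S. x e = 0"
          using \<open>S \<noteq> arcs G\<close> assms(5) by (auto simp: x_def)
        ultimately show False using \<open>L \<subseteq> XG\<close> sub by blast
      qed
    qed
  qed
qed

end
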